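(* Let $G=G(V,E)$ be a connected simple graph with $|V|=n$, and let $(O_t)_{t\ge0}$ be the Sliding-$(n+1)$ stochastic process on the acyclic orientations of $G_{\mathbf{r}}$. Let $S_{\mathbf{r}}$ be the set of acyclic orientations of $G_{\mathbf{r}}$ whose unique maximal element is $\mathbf{r}$. Then $\sum_{t\ge1}\mathbb{P}(O_t\in S_{\mathbf{r}})=\infty$, and for every $O\in S_{\mathbf{r}}$, $$\lim_{N\to\infty}\frac{\sum_{t=1}^N\mathbb{P}(O_t=O)}{\sum_{t=1}^N\mathbb{P}(O_t\in S_{\mathbf{r}})}=\frac{e(O|_V)}{n!},$$ where $O|_V$ is the restriction of $O$ to $E$ (an acyclic orientation of $G$). These results hold independently of the initial choice.
   Context: $G_{\mathbf{r}}$ is the graph on $V\sqcup\{\mathbf{r}\}$ obtained from $G$ by adding a vertex $\mathbf{r}$ adjacent to all vertices of $V$. Sliding-$(n+1)$ process: choose an arbitrary bijection $f_0:V\sqcup\{\mathbf{r}\}\to[n+1]$. For $t\ge1$, let $v_{t-1}$ be the vertex with $f_{t-1}(v_{t-1})=n+1$, choose $v_t$ uniformly at random from the neighbors of $v_{t-1}$ in $G_{\mathbf{r}}$, and let $f_t$ be $f_{t-1}$ with the values at $v_{t-1}$ and $v_t$ swapped. $O_t$ is the acyclic orientation of $G_{\mathbf{r}}$ with edge $\{u,v\}$ oriented $(u,v)$ iff $f_t(u)<f_t(v)$. An acyclic orientation is viewed as the poset it generates ($(u,v)$ meaning $u<v$); $e(\cdot)$ denotes the number of linear extensions, i.e. order-preserving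 bijections onto $[n]$. *)

theory Defs
  imports "HOL-Probability.Probability" "Graph_Theory.Graph_Theory"
begin

text \<open>
  A finite simple graph is a \<^locale>\<open>pair_graph\<close>: an irreflexive symmetric arc set, so the edge
  $\{u,v\}$ is the pair of arcs $(u,v)$, $(v,u)$.
\<close>

text \<open>The vertex set $V \sqcup \{\mathbf{r}\}$ is encoded by the option type, with $\mathbf{r}$ as \<^term>\<open>None\<close>.\<close>

definition add_root :: "'a pair_pre_digraph \<Rightarrow> 'a option pair_pre_digraph" where
  "add_root G =
     \<lparr> pverts = insert None (Some ` pverts G),
       parcs = {(Some u, Some v) | u v. (u, v) \<in> parcs G}
             \<union> {(None, Some v) | v. v \<in> pverts G}
             \<union> {(Some v, None) | v. v \<in> pverts G} \<rparr>"

definition neighbors :: "'a pair_pre_digraph \<Rightarrow> 'a \<Rightarrow> 'a set" where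
  "neighbors G v = {w. (v, w) \<in> parcs G}"

definition acyclic_orientation :: "'a pair_pre_digraph \<Rightarrow> 'a rel \<Rightarrow> bool" where
  "acyclic_orientation G D \<longleftrightarrow>
     D \<subseteq> parcs G \<and> (\<forall>(u, v) \<in> parcs G. (u, v) \<in> D \<longleftrightarrow> (v, u) \<notin> D) \<and> acyclic D"

definition generated_order :: "'a set \<Rightarrow> 'a rel \<Rightarrow> 'a rel" where
  "generated_order V D = Restr (D\<^sup>*) V"

definition maximal_elements :: "'a set \<Rightarrow> 'a rel \<Rightarrow> 'a set" where
  "maximal_elements V P = {x \<in> V. \<forall>y \<in> V. (x, y) \<in> P \<longrightarrow> y = x}"

text \<open>
  Bijections are taken extensional (undefined outside \<^term>\<open>V\<close>), so that each one is counted once.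
\<close>

definition linear_extensions :: "'a set \<Rightarrow> 'a rel \<Rightarrow> ('a \<Rightarrow> nat) set" where
  "linear_extensions V P =
     {g \<in> V \<rightarrow>\<^sub>E {1..card V}. bij_betw g V {1..card V} \<and> (\<forall>(x, y) \<in> P. g x \<le> g y)}"

definition num_linear_extensions :: "'a pair_pre_digraph \<Rightarrow> 'a rel \<Rightarrow> nat" where
  "num_linear_extensions G D =
     card (linear_extensions (pverts G) (generated_order (pverts G) D))"

definition root_maximal_orientations :: "'a pair_pre_digraph \<Rightarrow> 'a option rel set" where
  "root_maximal_orientations G =
     {D. acyclic_orientation (add_root G) D \<and>
         maximal_elements (pverts (add_root G)) (generated_order (pverts (add_root G)) D) = {None}}"

definition restrict_orientation :: "'a pair_pre_digraph \<Rightarrow> 'a option rel \<Rightarrow> 'a rel" where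
  "restrict_orientation G D = {(u, v) \<in> parcs G. (Some u, Some v) \<in> D}"

definition induced_orientation :: "'a pair_pre_digraph \<Rightarrow> ('a \<Rightarrow> nat) \<Rightarrow> 'a rel" where
  "induced_orientation H f = {(u, v) \<in> parcs H. f u < f v}"

definition top_vertex :: "'a pair_pre_digraph \<Rightarrow> ('a \<Rightarrow> nat) \<Rightarrow> 'a" where
  "top_vertex H f = (THE v. v \<in> pverts H \<and> f v = card (pverts H))"

definition slide :: "'a pair_pre_digraph \<Rightarrow> ('a \<Rightarrow> nat) \<Rightarrow> ('a \<Rightarrow> nat) pmf" where
  "slide H f = do {
     let v = top_vertex H f;
     w \<leftarrow> pmf_of_set (neighbors H v);
     return_pmf (f(v := f w, w := f v))
   }"

text \<open>
  The law of $f_t$ on a graph \<^term>\<open>H\<close> with $n+1$ vertices, started from the labelling \<^term>\<open>f0\<close>.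
\<close>

primrec sliding_labelling ::
    "'a pair_pre_digraph \<Rightarrow> ('a \<Rightarrow> nat) \<Rightarrow> nat \<Rightarrow> ('a \<Rightarrow> nat) pmf" where
  "sliding_labelling H f0 0 = return_pmf f0"
| "sliding_labelling H f0 (Suc t) = bind_pmf (sliding_labelling H f0 t) (slide H)"

text \<open>The law of $O_t$.\<close>

definition sliding_orientation ::
    "'a pair_pre_digraph \<Rightarrow> ('a option \<Rightarrow> nat) \<Rightarrow> nat \<Rightarrow> 'a option rel pmf" where
  "sliding_orientation G f0 t =
     map_pmf (induced_orientation (add_root G)) (sliding_labelling (add_root G) f0 t)"

lemma pair_graph_add_root:
  assumes "pair_graph G"
  shows "pair_graph (add_root G)"
proof -
  interpret pair_graph G by fact
  have eq: "parcs (add_root G) = (\<lambda>(u, v). (Some u, Some v)) ` parcs G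
      \<union> (\<lambda>v. (None, Some v)) ` pverts G \<union> (\<lambda>v. (Some v, None)) ` pverts G"
    by (auto simp: add_root_def)
  have "finite (parcs (add_root G))"
    unfolding eq by (intro finite_UnI finite_imageI pair_finite_arcs pair_finite_verts)
  moreover have "symmetric (with_proj (add_root G))"
    unfolding symmetric_def sym_def
    by (auto simp: add_root_def intro: arcs_symmetric)
  ultimately show ?thesis
    by unfold_locales
      (auto simp: add_root_def pair_finite_verts dest: in_arcsD1 in_arcsD2 no_loops')
qed

lemma acyclic_orientation_induced:
  assumes "pair_graph H" and "inj_on f (pverts H)"
  shows "acyclic_orientation H (induced_orientation H f)"
proof -
  interpret pair_graph H by fact
  have "f u < f v" if "(u, v) \<in> (induced_orientation H f)\<^sup>+" for u v
    using that by induction (auto simp: induced_orientation_def)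
  then have "acyclic (induced_orientation H f)"
    by (fastforce simp: acyclic_def)
  moreover have "f u < f v \<longleftrightarrow> \<not> f v < f u" if "(u, v) \<in> parcs H" for u v
    using that assms(2) no_loops'[OF that] in_arcsD1[OF that] in_arcsD2[OF that]
    by (metis inj_onD linorder_neqE_nat order_less_asym)
  ultimately show ?thesis
    by (auto simp: acyclic_orientation_def induced_orientation_def dest: arcs_symmetric)
qed

lemma acyclic_orientation_restrict:
  assumes "acyclic_orientation (add_root G) D"
  shows "acyclic_orientation G (restrict_orientation G D)"
proof -
  have "(Some u, Some v) \<in> D\<^sup>+" if "(u, v) \<in> (restrict_orientation G D)\<^sup>+" for u v
    using that
    by induction (auto simp: restrict_orientation_def intro: trancl_into_trancl)
  then have "acyclic (restrict_orientation G D)"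
    using assms unfolding acyclic_orientation_def acyclic_def by blast
  moreover have "(v, u) \<in> parcs G" if "(Some v, Some u) \<in> D" for u v
    using that assms by (auto simp: acyclic_orientation_def add_root_def)
  moreover have "(Some u, Some v) \<in> D \<longleftrightarrow> (Some v, Some u) \<notin> D" if "(u, v) \<in> parcs G" for u v
  proof -
    have "(Some u, Some v) \<in> parcs (add_root G)"
      using that by (simp add: add_root_def)
    then show ?thesis
      using assms unfolding acyclic_orientation_def by fast
  qed
  ultimately show ?thesis
    unfolding acyclic_orientation_def restrict_orientation_def by auto
qed

end

theory Submission
  imports Defs
begin

text \<open>
  For a finite irreducible chain with invariant measure $\pi$, the expected number of visits to $x$
  up to time $N$ is asymptotically proportional to $\pi(x)$. Indeed, as a function of $x$ it
  satisfies the equation of an invariant measure except for the contributions of the first and the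
  last time, so its quotient by $\pi$ has bounded Laplacian with respect to the time-reversed chain.
  By a maximum principle, a function with bounded Laplacian on a finite strongly connected network
  has bounded oscillation; as the total number of visits is $N$, these quotients tend to infinity
  and their ratios tend to 1.

  The labelling process is the simple random walk on a finite graph whose vertices are the
  labellings of $G_{\mathbf{r}}$, with the degree as invariant measure. This graph is connected:
  moving the top label around a triangle through $\mathbf{r}$ swaps the labels of two adjacent
  vertices of $G$, and transpositions along the edges of a connected graph generate all
  permutations. The $n!$ labellings with the top label at $\mathbf{r}$ have the same degree $n$, so
  they are visited equally often in the limit. Those inducing the orientation $O$ are its linear
  extensions, and correspond to the linear extensions of $O|_V$ because $\mathbf{r}$ is the largest
  element of $O$.
\<close>

section \<open>Functions of bounded Laplacian\<close>

locale strongly_connected_network =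
  fixes S :: "'s set" and c :: "'s \<Rightarrow> 's \<Rightarrow> real"
  assumes finite_nodes: "finite S"
    and weight_nonneg: "x \<in> S \<Longrightarrow> y \<in> S \<Longrightarrow> 0 \<le> c x y"
    and strongly_connected:
      "x \<in> S \<Longrightarrow> y \<in> S \<Longrightarrow> (x, y) \<in> {(x, y). x \<in> S \<and> y \<in> S \<and> 0 < c x y}\<^sup>*"
begin

definition laplacian :: "('s \<Rightarrow> real) \<Rightarrow> 's \<Rightarrow> real" where
  "laplacian h x = (\<Sum>y\<in>S. c x y * (h x - h y))"

lemma gap_neighbor_le:
  assumes "x \<in> S" and "y \<in> S" and "laplacian h x \<le> 1" and "\<And>z. z \<in> S \<Longrightarrow> h z \<le> M"
  shows "c x y * (M - h y) \<le> 1 + (\<Sum>z\<in>S. c x z) * (M - h x)"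
proof -
  have "c x y * (M - h y) \<le> (\<Sum>z\<in>S. c x z * (M - h z))"
    using assms finite_nodes weight_nonneg by (intro member_le_sum) auto
  also have "\<dots> = laplacian h x + (\<Sum>z\<in>S. c x z) * (M - h x)"
    unfolding laplacian_def sum_distrib_right sum.distrib[symmetric]
    by (intro sum.cong refl) (simp add: algebra_simps)
  finally show ?thesis using assms(3) by simp
qed

lemma eventually_gap_from_maximum_le:
  assumes "(x, z) \<in> {(x, y). x \<in> S \<and> y \<in> S \<and> 0 < c x y}\<^sup>*"
  shows "\<forall>\<^sub>F C in at_top. \<forall>h. (\<forall>y\<in>S. laplacian h y \<le> 1) \<longrightarrow> (\<forall>y\<in>S. h y \<le> h x) \<longrightarrow> h x - h z \<le> C"
  using assms
proof induction
  case base
  show ?case using eventually_ge_at_top[of 0] by eventually_elim simp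
next
  case (step y z)
  then have y: "y \<in> S" and z: "z \<in> S" and weight: "0 < c y z" by auto
  obtain C where C: "\<And>h. \<forall>y\<in>S. laplacian h y \<le> 1 \<Longrightarrow> \<forall>y\<in>S. h y \<le> h x \<Longrightarrow> h x - h y \<le> C"
    using eventually_happens'[OF trivial_limit_at_top_linorder step.IH] by blast
  have "h x - h z \<le> (1 + (\<Sum>w\<in>S. c y w) * C) / c y z"
    if lap: "\<forall>y\<in>S. laplacian h y \<le> 1" and max: "\<forall>y\<in>S. h y \<le> h x" for h
  proof -
    have "c y z * (h x - h z) \<le> 1 + (\<Sum>w\<in>S. c y w) * (h x - h y)"
      using y z lap max by (intro gap_neighbor_le) auto
    also have "\<dots> \<le> 1 + (\<Sum>w\<in>S. c y w) * C"
      using C[OF lap max] y weight_nonneg by (intro add_left_mono mult_left_mono sum_nonneg) auto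
    finally show ?thesis
      using weight by (simp add: field_simps)
  qed
  with eventually_ge_at_top[of "(1 + (\<Sum>w\<in>S. c y w) * C) / c y z"] show ?case
    by (elim eventually_mono) (blast intro: order_trans)
qed

lemma bounded_laplacian_imp_bounded_oscillation:
  obtains C where
    "\<And>h x y. (\<And>z. z \<in> S \<Longrightarrow> laplacian h z \<le> 1) \<Longrightarrow> x \<in> S \<Longrightarrow> y \<in> S \<Longrightarrow> h x - h y \<le> C"
proof -
  have "\<forall>\<^sub>F C in at_top. \<forall>x\<in>S. \<forall>z\<in>S. \<forall>h. (\<forall>y\<in>S. laplacian h y \<le> 1) \<longrightarrow>
      (\<forall>y\<in>S. h y \<le> h x) \<longrightarrow> h x - h z \<le> C"
    by (intro eventually_ball_finite finite_nodes ballI eventually_gap_from_maximum_le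
        strongly_connected)
  from eventually_happens'[OF trivial_limit_at_top_linorder this]
  obtain C where C: "\<forall>x\<in>S. \<forall>z\<in>S. \<forall>h. (\<forall>y\<in>S. laplacian h y \<le> 1) \<longrightarrow>
      (\<forall>y\<in>S. h y \<le> h x) \<longrightarrow> h x - h z \<le> C" ..
  show ?thesis
  proof
    fix h x y assume lap: "\<And>z. z \<in> S \<Longrightarrow> laplacian h z \<le> 1" and x: "x \<in> S" and y: "y \<in> S"
    obtain m where "m \<in> S" and "Max (h ` S) = h m"
      using obtains_MAX[OF finite_nodes, of h] x by auto
    then have max: "\<forall>z\<in>S. h z \<le> h m"
      using finite_nodes by (metis Max_ge finite_imageI imageI)
    then have "h m - h y \<le> C" using C \<open>m \<in> S\<close> lap y by blast
    moreover have "h x \<le> h m" using max x by blast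
    ultimately show "h x - h y \<le> C" by linarith
  qed
qed

end

section \<open>Visits of a finite irreducible Markov chain\<close>

locale finite_irreducible_chain =
  fixes S :: "'s set" and K :: "'s \<Rightarrow> 's pmf" and \<pi> :: "'s \<Rightarrow> real" and \<mu> :: "nat \<Rightarrow> 's pmf"
  assumes finite_states: "finite S"
    and closed: "x \<in> S \<Longrightarrow> set_pmf (K x) \<subseteq> S"
    and irreducible: "x \<in> S \<Longrightarrow> y \<in> S \<Longrightarrow> (x, y) \<in> {(x, y). x \<in> S \<and> y \<in> set_pmf (K x)}\<^sup>*"
    and weight_pos: "x \<in> S \<Longrightarrow> 0 < \<pi> x"
    and invariant: "y \<in> S \<Longrightarrow> (\<Sum>x\<in>S. \<pi> x * pmf (K x) y) = \<pi> y"
    and set_pmf_start: "set_pmf (\<mu> 0) \<subseteq> S"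
    and law_Suc: "\<mu> (Suc t) = bind_pmf (\<mu> t) K"
begin

sublocale time_reversal: strongly_connected_network S "\<lambda>y x. \<pi> x * pmf (K x) y"
proof
  fix x y assume "x \<in> S" "y \<in> S"
  have "{(x, y). x \<in> S \<and> y \<in> S \<and> 0 < \<pi> y * pmf (K y) x}
      = {(x, y). x \<in> S \<and> y \<in> set_pmf (K x)}\<inverse>"
    using closed weight_pos by (auto simp: zero_less_mult_iff pmf_positive_iff dest: less_asym)
  with irreducible[OF \<open>y \<in> S\<close> \<open>x \<in> S\<close>]
  show "(x, y) \<in> {(x, y). x \<in> S \<and> y \<in> S \<and> 0 < \<pi> y * pmf (K y) x}\<^sup>*"
    by (simp add: rtrancl_converse)
qed (use finite_states weight_pos in \<open>auto simp: less_imp_le\<close>)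

lemma set_pmf_law: "set_pmf (\<mu> t) \<subseteq> S"
proof (induction t)
  case (Suc t)
  with closed show ?case by (auto simp: law_Suc)
qed (rule set_pmf_start)

lemma pmf_law_Suc: "pmf (\<mu> (Suc t)) y = (\<Sum>x\<in>S. pmf (\<mu> t) x * pmf (K x) y)"
  unfolding law_Suc pmf_bind
  by (subst integral_measure_pmf_real[OF finite_states])
    (use set_pmf_law in \<open>auto simp: mult.commute\<close>)

definition visits :: "nat \<Rightarrow> 's \<Rightarrow> real" where
  "visits N x = (\<Sum>t=1..N. pmf (\<mu> t) x)"

lemma sum_prob_eq_sum_visits:
  assumes "A \<subseteq> S"
  shows "(\<Sum>t=1..N. measure_pmf.prob (\<mu> t) A) = (\<Sum>x\<in>A. visits N x)"
proof -
  have "finite A" using assms finite_states finite_subset by blast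
  then show ?thesis
    unfolding visits_def by (simp add: measure_measure_pmf_finite) (rule sum.swap)
qed

lemma sum_visits: "(\<Sum>x\<in>S. visits N x) = N"
proof -
  have "measure_pmf.prob (\<mu> t) S = 1" for t
    using set_pmf_law by (simp add: measure_pmf.prob_eq_1 AE_measure_pmf_iff subset_iff)
  then show ?thesis
    by (simp flip: sum_prob_eq_sum_visits)
qed

lemma visits_balance:
  "(\<Sum>x\<in>S. visits N x * pmf (K x) y) = visits N y + pmf (\<mu> (Suc N)) y - pmf (\<mu> 1) y"
proof (induction N)
  case (Suc N)
  have "(\<Sum>x\<in>S. visits (Suc N) x * pmf (K x) y)
      = (\<Sum>x\<in>S. visits N x * pmf (K x) y) + (\<Sum>x\<in>S. pmf (\<mu> (Suc N)) x * pmf (K x) y)"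
    by (simp add: visits_def distrib_right sum.distrib)
  also have "\<dots> = visits (Suc N) y + pmf (\<mu> (Suc (Suc N))) y - pmf (\<mu> 1) y"
    using Suc pmf_law_Suc[of "Suc N" y] by (simp add: visits_def)
  finally show ?case .
qed (simp add: visits_def)

definition normalized_visits :: "nat \<Rightarrow> 's \<Rightarrow> real" where
  "normalized_visits N x = visits N x / \<pi> x"

lemma visits_eq: "x \<in> S \<Longrightarrow> visits N x = \<pi> x * normalized_visits N x"
  using weight_pos[of x] by (simp add: normalized_visits_def)

lemma laplacian_normalized_visits_le:
  assumes "y \<in> S"
  shows "time_reversal.laplacian (normalized_visits N) y \<le> 1"
proof -
  have "time_reversal.laplacian (normalized_visits N) y
      = (\<Sum>x\<in>S. \<pi> x * pmf (K x) y) * normalized_visits N y - (\<Sum>x\<in>S. visits N x * pmf (K x) y)"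
    unfolding time_reversal.laplacian_def sum_distrib_right sum_subtractf[symmetric]
    by (intro sum.cong refl) (simp add: visits_eq algebra_simps)
  also have "\<dots> = pmf (\<mu> 1) y - pmf (\<mu> (Suc N)) y"
    using visits_eq[OF assms] by (simp add: invariant[OF assms] visits_balance)
  also have "\<dots> \<le> 1"
    using pmf_le_1[of "\<mu> 1" y] pmf_nonneg[of "\<mu> (Suc N)" y] by linarith
  finally show ?thesis .
qed

lemma normalized_visits_bounded_oscillation:
  obtains C where
    "\<And>N x y. x \<in> S \<Longrightarrow> y \<in> S \<Longrightarrow> normalized_visits N x - normalized_visits N y \<le> C"
  by (rule time_reversal.bounded_laplacian_imp_bounded_oscillation)
    (use laplacian_normalized_visits_le in blast)

lemma normalized_visits_at_top:
  assumes "x \<in> S"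
  shows "filterlim (\<lambda>N. normalized_visits N x) at_top sequentially"
proof -
  obtain C where C: "\<And>N x y. x \<in> S \<Longrightarrow> y \<in> S \<Longrightarrow> normalized_visits N x - normalized_visits N y \<le> C"
    using normalized_visits_bounded_oscillation by blast
  define mass where "mass = (\<Sum>y\<in>S. \<pi> y)"
  have "0 < mass"
    unfolding mass_def using assms finite_states weight_pos by (intro sum_pos) auto
  have "real N / mass - C \<le> normalized_visits N x" for N
  proof -
    have "real N = (\<Sum>y\<in>S. \<pi> y * normalized_visits N y)"
      using sum_visits[of N] by (simp add: visits_eq)
    also have "\<dots> \<le> (\<Sum>y\<in>S. \<pi> y * (normalized_visits N x + C))"
    proof (intro sum_mono mult_left_mono)
      fix y assume "y \<in> S"
      with C[OF this assms, of N] weight_pos[of y]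
      show "normalized_visits N y \<le> normalized_visits N x + C" "0 \<le> \<pi> y" by auto
    qed
    also have "\<dots> = mass * (normalized_visits N x + C)"
      by (simp add: mass_def sum_distrib_right)
    finally show ?thesis
      using \<open>0 < mass\<close> by (simp add: field_simps)
  qed
  moreover have "filterlim (\<lambda>N. real N / mass - C) at_top sequentially"
    using \<open>0 < mass\<close> by real_asymp
  ultimately show ?thesis
    by (auto intro: filterlim_at_top_mono)
qed

lemma visits_at_top:
  assumes "x \<in> S"
  shows "filterlim (\<lambda>N. visits N x) at_top sequentially"
  unfolding visits_eq[OF assms]
  by (rule filterlim_tendsto_pos_mult_at_top[OF tendsto_const weight_pos normalized_visits_at_top])
    (use assms in auto)

lemma normalized_visits_ratio_tendsto:
  assumes "x \<in> S" and "y \<in> S"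
  shows "(\<lambda>N. normalized_visits N y / normalized_visits N x) \<longlonglongrightarrow> 1"
proof -
  obtain C where C: "\<And>N x y. x \<in> S \<Longrightarrow> y \<in> S \<Longrightarrow> normalized_visits N x - normalized_visits N y \<le> C"
    using normalized_visits_bounded_oscillation by blast
  have "(\<lambda>N. C / normalized_visits N x) \<longlonglongrightarrow> 0"
    using normalized_visits_at_top[OF assms(1)]
    by (intro tendsto_divide_0[OF tendsto_const] filterlim_at_top_imp_at_infinity)
  moreover have "\<forall>\<^sub>F N in sequentially.
      norm (normalized_visits N y / normalized_visits N x - 1) \<le> C / normalized_visits N x"
    using normalized_visits_at_top[OF assms(1), unfolded filterlim_at_top_dense, rule_format, of 0]
  proof eventually_elim
    case (elim N)
    have "\<bar>normalized_visits N y - normalized_visits N x\<bar> \<le> C"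
      using C[OF assms, of N] C[OF assms(2,1), of N] by linarith
    then have "\<bar>normalized_visits N y - normalized_visits N x\<bar> / normalized_visits N x
        \<le> C / normalized_visits N x"
      using elim by (intro divide_right_mono) auto
    moreover have "normalized_visits N y / normalized_visits N x - 1
        = (normalized_visits N y - normalized_visits N x) / normalized_visits N x"
      using elim by (simp add: diff_divide_distrib)
    ultimately show ?case
      using elim by simp
  qed
  ultimately have "(\<lambda>N. normalized_visits N y / normalized_visits N x - 1) \<longlonglongrightarrow> 0"
    by (rule Lim_null_comparison[rotated])
  then show ?thesis by (simp add: LIM_zero_iff)
qed

lemma sum_visits_ratio_tendsto:
  assumes "A \<subseteq> S" and "x \<in> S"
  shows "(\<lambda>N. (\<Sum>y\<in>A. visits N y) / normalized_visits N x) \<longlonglongrightarrow> (\<Sum>y\<in>A. \<pi> y)"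
proof -
  have "(\<lambda>N. \<Sum>y\<in>A. \<pi> y * (normalized_visits N y / normalized_visits N x)) \<longlonglongrightarrow> (\<Sum>y\<in>A. \<pi> y * 1)"
    using assms
    by (intro tendsto_sum tendsto_mult tendsto_const normalized_visits_ratio_tendsto) auto
  moreover have "(\<Sum>y\<in>A. \<pi> y * (normalized_visits N y / normalized_visits N x))
      = (\<Sum>y\<in>A. visits N y) / normalized_visits N x" for N
    unfolding sum_divide_distrib using assms(1) by (intro sum.cong) (auto simp: visits_eq)
  ultimately show ?thesis by simp
qed

lemma sum_prob_ratio_tendsto:
  assumes "A \<subseteq> S" and "A \<noteq> {}" and "B \<subseteq> S"
  shows "(\<lambda>N. (\<Sum>t=1..N. measure_pmf.prob (\<mu> t) B) / (\<Sum>t=1..N. measure_pmf.prob (\<mu> t) A))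
    \<longlonglongrightarrow> (\<Sum>x\<in>B. \<pi> x) / (\<Sum>x\<in>A. \<pi> x)"
proof -
  obtain a where "a \<in> S" using assms(1,2) by blast
  have "0 < (\<Sum>x\<in>A. \<pi> x)"
    using assms finite_subset[OF assms(1) finite_states] weight_pos by (intro sum_pos) auto
  then have "(\<lambda>N. ((\<Sum>x\<in>B. visits N x) / normalized_visits N a) /
      ((\<Sum>x\<in>A. visits N x) / normalized_visits N a)) \<longlonglongrightarrow> (\<Sum>x\<in>B. \<pi> x) / (\<Sum>x\<in>A. \<pi> x)"
    using assms \<open>a \<in> S\<close> by (intro tendsto_divide sum_visits_ratio_tendsto) auto
  moreover
  have "\<forall>\<^sub>F N in sequentially. normalized_visits N a \<noteq> 0"
    using filterlim_at_top_imp_at_infinity[OF normalized_visits_at_top[OF \<open>a \<in> S\<close>]]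
    by (rule filterlim_at_infinity_imp_eventually_ne)
  then have "\<forall>\<^sub>F N in sequentially.
      ((\<Sum>x\<in>B. visits N x) / normalized_visits N a) / ((\<Sum>x\<in>A. visits N x) / normalized_visits N a)
      = (\<Sum>x\<in>B. visits N x) / (\<Sum>x\<in>A. visits N x)"
    by eventually_elim simp
  ultimately show ?thesis
    unfolding sum_prob_eq_sum_visits[OF assms(1)] sum_prob_eq_sum_visits[OF assms(3)]
    by (rule Lim_transform_eventually)
qed

lemma suminf_prob_eq_infinity:
  assumes "A \<subseteq> S" and "A \<noteq> {}"
  shows "(\<Sum>t. ennreal (measure_pmf.prob (\<mu> (t + 1)) A)) = \<infinity>"
proof -
  obtain a where a: "a \<in> A" "a \<in> S" using assms by blast
  have "visits N a \<le> (\<Sum>t<N. measure_pmf.prob (\<mu> (t + 1)) A)" for N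
    unfolding visits_def using a(1)
    by (auto simp: sum.atLeast1_atMost_eq simp flip: measure_pmf_single
        intro!: sum_mono measure_pmf.finite_measure_mono)
  then have "filterlim (\<lambda>N. \<Sum>t<N. measure_pmf.prob (\<mu> (t + 1)) A) at_top sequentially"
    using visits_at_top[OF a(2)] by (auto intro: filterlim_at_top_mono)
  then have "(\<lambda>N. \<Sum>t<N. ennreal (measure_pmf.prob (\<mu> (t + 1)) A)) \<longlonglongrightarrow> \<infinity>"
    by (simp add: sum_ennreal sum_nonneg ennreal_tendsto_top_eq_at_top)
  then show ?thesis
    by (rule LIMSEQ_unique[OF summable_LIMSEQ[OF summableI]])
qed

end

lemma simple_random_walk_degree_invariant:
  assumes "finite S" and "\<And>x. x \<in> S \<Longrightarrow> nb x \<subseteq> S" and "\<And>x. x \<in> S \<Longrightarrow> nb x \<noteq> {}"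
    and sym: "\<And>x y. x \<in> S \<Longrightarrow> y \<in> nb x \<Longrightarrow> x \<in> nb y" and "y \<in> S"
  shows "(\<Sum>x\<in>S. card (nb x) * pmf (pmf_of_set (nb x)) y) = card (nb y)"
proof -
  have "card (nb x) * pmf (pmf_of_set (nb x)) y = of_bool (x \<in> nb y)" if "x \<in> S" for x
  proof -
    have "finite (nb x)" using assms(1,2) that finite_subset by blast
    moreover have "y \<in> nb x \<longleftrightarrow> x \<in> nb y" using sym \<open>x \<in> S\<close> \<open>y \<in> S\<close> by blast
    ultimately show ?thesis using assms(3)[OF that] by simp
  qed
  then have "(\<Sum>x\<in>S. card (nb x) * pmf (pmf_of_set (nb x)) y) = (\<Sum>x\<in>S. of_bool (x \<in> nb y))"
    by (rule sum.cong[OF refl])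
  also have "\<dots> = card (nb y)"
    using assms(1) assms(2)[OF \<open>y \<in> S\<close>] by (simp add: sum_of_bool_eq Int_absorb1)
  finally show ?thesis .
qed

section \<open>Transpositions along the arcs of a connected graph\<close>

lemma permutes_connected_induct [consumes 4, case_names id transpose]:
  assumes connected: "S \<times> S \<subseteq> R\<^sup>*" and "R \<subseteq> S \<times> S" and "finite S" and "p permutes S"
    and "P id"
    and transpose: "\<And>p a b. p permutes S \<Longrightarrow> P p \<Longrightarrow> (a, b) \<in> R \<Longrightarrow>
      P (p \<circ> Transposition.transpose a b)"
  shows "P p"
  using assms(3,4)
proof (induction rule: permutes_rev_induct)
  case (swap a b p)
  have "P (p \<circ> Transposition.transpose a b)" if "(a, b) \<in> R\<^sup>*" "p permutes S" "P p" for p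
    using that
  proof (induction arbitrary: p)
    case (step b c)
    have "b \<in> S" "c \<in> S" using \<open>(b, c) \<in> R\<close> \<open>R \<subseteq> S \<times> S\<close> by auto
    let ?ab = "Transposition.transpose a b" and ?bc = "Transposition.transpose b c"
    have permutes: "?ab permutes S" "?bc permutes S"
      using \<open>a \<in> S\<close> \<open>b \<in> S\<close> \<open>c \<in> S\<close> by (auto intro: permutes_swap_id)
    show ?case
    proof (cases "a = c \<or> b = c")
      case True
      with step show ?thesis by auto
    next
      case False
      have "P (p \<circ> ?ab \<circ> ?bc \<circ> ?ab)"
        using step permutes by (intro step.IH transpose permutes_compose)
      moreover have "?ab \<circ> ?bc \<circ> ?ab = Transposition.transpose a c"
        using False by (auto simp: fun_eq_iff Transposition.transpose_def)
      ultimately show ?thesis by (simp only: comp_assoc)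
    qed
  qed simp
  with swap connected show ?case by blast
qed (rule \<open>P id\<close>)

section \<open>Acyclic orientations and linear extensions\<close>

lemma acyclic_orientation_subset_imp_eq:
  assumes "acyclic_orientation H D" and "acyclic_orientation H E" and "D \<subseteq> E"
  shows "D = E"
  using assms unfolding acyclic_orientation_def by fast

lemma induced_orientation_eq_iff:
  assumes "pair_graph H" and inj: "inj_on f (pverts H)" and D: "acyclic_orientation H D"
  shows "induced_orientation H f = D \<longleftrightarrow> (\<forall>(x, y)\<in>generated_order (pverts H) D. f x \<le> f y)"
proof
  assume eq: "induced_orientation H f = D"
  have "f x \<le> f y" if "(x, y) \<in> D\<^sup>*" for x y
    using that by induction (auto simp: induced_orientation_def simp flip: eq)
  then show "\<forall>(x, y)\<in>generated_order (pverts H) D. f x \<le> f y"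
    by (auto simp: generated_order_def)
next
  interpret pair_graph H by fact
  assume mono: "\<forall>(x, y)\<in>generated_order (pverts H) D. f x \<le> f y"
  have "(x, y) \<in> induced_orientation H f" if "(x, y) \<in> D" for x y
  proof -
    have arc: "(x, y) \<in> parcs H" using that D by (auto simp: acyclic_orientation_def)
    then have "x \<in> pverts H" "y \<in> pverts H" "x \<noteq> y"
      using in_arcsD1 in_arcsD2 no_loops' by blast+
    with that mono have "f x \<le> f y" "f x \<noteq> f y"
      using inj by (auto simp: generated_order_def dest: inj_onD)
    with arc show ?thesis by (simp add: induced_orientation_def)
  qed
  then have "D \<subseteq> induced_orientation H f" by auto
  with D acyclic_orientation_induced[OF \<open>pair_graph H\<close> inj] show "induced_orientation H f = D"
    by (rule acyclic_orientation_subset_imp_eq[symmetric])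
qed

lemma bij_betw_option_iff:
  assumes "f None = Suc n"
  shows "bij_betw f (insert None (Some ` V)) {1..Suc n} \<longleftrightarrow> bij_betw (f \<circ> Some) V {1..n}"
proof -
  have "bij_betw f (insert None (Some ` V)) {1..Suc n} \<longleftrightarrow> bij_betw f (Some ` V) {1..n}"
    using notIn_Un_bij_betw3[of None "Some ` V" f "{1..n}"] assms
    by (simp add: atLeastAtMostSuc_conv)
  also have "\<dots> \<longleftrightarrow> bij_betw (f \<circ> Some) V {1..n}"
    by (rule bij_betw_comp_iff) (simp add: bij_betw_def)
  finally show ?thesis .
qed

lemma linear_extension_top:
  assumes "f \<in> linear_extensions W P" and "m \<in> W" and "\<And>x. x \<in> W \<Longrightarrow> x \<noteq> m \<Longrightarrow> (x, m) \<in> P"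
  shows "f m = card W"
proof -
  have bij: "bij_betw f W {1..card W}" and mono: "\<And>x y. (x, y) \<in> P \<Longrightarrow> f x \<le> f y"
    using assms(1) by (auto simp: linear_extensions_def)
  have "finite W" using bij bij_betw_finite by blast
  with \<open>m \<in> W\<close> have "card W \<in> {1..card W}" by (auto simp: Suc_le_eq card_gt_0_iff)
  then obtain x where "x \<in> W" "f x = card W"
    using bij by (metis bij_betw_imp_surj_on imageE)
  then have "card W \<le> f m" using assms(3) mono by (cases "x = m") fastforce+
  moreover have "f m \<le> card W" using bij_betwE[OF bij] \<open>m \<in> W\<close> by auto
  ultimately show ?thesis by simp
qed

definition extend_by_top :: "'a set \<Rightarrow> ('a \<Rightarrow> nat) \<Rightarrow> 'a option \<Rightarrow> nat" where
  "extend_by_top V h x =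
    (case x of None \<Rightarrow> Suc (card V) | Some v \<Rightarrow> if v \<in> V then h v else undefined)"

lemma extend_by_top_linear_extension:
  assumes "finite V" and P: "P \<subseteq> insert None (Some ` V) \<times> insert None (Some ` V)"
    and maximal: "\<And>v. (None, Some v) \<notin> P"
    and h: "h \<in> linear_extensions V {(u, v). (Some u, Some v) \<in> P}"
  shows "extend_by_top V h \<in> linear_extensions (insert None (Some ` V)) P"
proof -
  have "bij_betw (extend_by_top V h \<circ> Some) V {1..card V} \<longleftrightarrow> bij_betw h V {1..card V}"
    by (rule bij_betw_cong) (simp add: extend_by_top_def)
  with h have bij: "bij_betw (extend_by_top V h) (insert None (Some ` V)) {1..Suc (card V)}"
    by (subst bij_betw_option_iff) (auto simp: linear_extensions_def extend_by_top_def)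
  have "extend_by_top V h x \<le> extend_by_top V h y" if xy: "(x, y) \<in> P" for x y
  proof (cases y)
    case None
    have "x \<in> insert None (Some ` V)" using xy P by blast
    with bij_betwE[OF bij] have "extend_by_top V h x \<le> Suc (card V)" by force
    with None show ?thesis by (simp add: extend_by_top_def)
  next
    case (Some v)
    with xy maximal obtain u where "x = Some u" by (cases x) auto
    with Some xy P h show ?thesis by (auto simp: linear_extensions_def extend_by_top_def)
  qed
  moreover have "extend_by_top V h \<in> insert None (Some ` V) \<rightarrow>\<^sub>E {1..Suc (card V)}"
    using bij_betwE[OF bij] by (auto simp: extend_by_top_def split: option.splits if_splits)
  ultimately show ?thesis
    using bij \<open>finite V\<close> by (simp add: linear_extensions_def card_image split_def)
qed

lemma card_linear_extensions_add_top:
  assumes "finite V" and P: "P \<subseteq> insert None (Some ` V) \<times> insert None (Some ` V)"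
    and top: "\<And>v. v \<in> V \<Longrightarrow> (Some v, None) \<in> P" and maximal: "\<And>v. (None, Some v) \<notin> P"
  shows "card (linear_extensions (insert None (Some ` V)) P)
    = card (linear_extensions V {(u, v). (Some u, Some v) \<in> P})"
    (is "card ?E = card ?F")
proof -
  have top_value: "f None = Suc (card V)" if "f \<in> ?E" for f
    using linear_extension_top[OF that, of None] top \<open>finite V\<close> by (auto simp: card_image)
  have "bij_betw (\<lambda>f. restrict (f \<circ> Some) V) ?E ?F"
  proof (rule bij_betw_byWitness[where f' = "extend_by_top V"])
    show "\<forall>f\<in>?E. extend_by_top V (restrict (f \<circ> Some) V) = f"
    proof (intro ballI ext)
      fix f x assume f: "f \<in> ?E"
      then have "f \<in> extensional (insert None (Some ` V))"
        by (auto simp: linear_extensions_def PiE_def)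
      with top_value[OF f] show "extend_by_top V (restrict (f \<circ> Some) V) x = f x"
        by (auto simp: extend_by_top_def extensional_def split: option.split)
    qed
    show "\<forall>h\<in>?F. restrict (extend_by_top V h \<circ> Some) V = h"
      by (auto simp: linear_extensions_def PiE_def extensional_def extend_by_top_def fun_eq_iff)
    show "(\<lambda>f. restrict (f \<circ> Some) V) ` ?E \<subseteq> ?F"
    proof clarify
      fix f assume f: "f \<in> ?E"
      then have "bij_betw (f \<circ> Some) V {1..card V}"
        using bij_betw_option_iff[of f "card V" V] top_value[OF f] \<open>finite V\<close>
        by (simp add: linear_extensions_def card_image)
      with f P show "restrict (f \<circ> Some) V \<in> ?F"
        by (auto simp: linear_extensions_def dest: bij_betwE)
    qed
    show "extend_by_top V ` ?F \<subseteq> ?E"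
      using extend_by_top_linear_extension[OF assms(1,2,4)] by blast
  qed
  then show ?thesis by (rule bij_betw_same_card)
qed

section \<open>Orientations with the root as unique maximal element\<close>

lemma pverts_add_root: "pverts (add_root G) = insert None (Some ` pverts G)"
  by (simp add: add_root_def)

lemma root_maximal_orientations_eq:
  "root_maximal_orientations G =
    {D. acyclic_orientation (add_root G) D \<and> (\<forall>v\<in>pverts G. (Some v, None) \<in> D)}"
  (is "_ = {D. ?acyclic D \<and> ?to_root D}")
proof (intro set_eqI iffI; clarify)
  fix D
  assume D: "D \<in> root_maximal_orientations G"
  then have acyclic: "?acyclic D"
    and "None \<in> maximal_elements (pverts (add_root G)) (generated_order (pverts (add_root G)) D)"
    by (auto simp: root_maximal_orientations_def)
  then have "(None, Some v) \<notin> D" if "v \<in> pverts G" for v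
    using that by (auto simp: maximal_elements_def generated_order_def pverts_add_root)
  moreover have "(Some v, None) \<in> parcs (add_root G)" if "v \<in> pverts G" for v
    using that by (simp add: add_root_def)
  ultimately show "?acyclic D \<and> ?to_root D"
    using acyclic unfolding acyclic_orientation_def by blast
next
  fix D
  assume acyclic: "?acyclic D" and to_root: "?to_root D"
  have "(None, y) \<notin> D" for y
    using acyclic to_root unfolding acyclic_orientation_def add_root_def by fastforce
  then have "y = None" if "(None, y) \<in> D\<^sup>*" for y
    using that by (auto elim: converse_rtranclE)
  moreover have "(x, None) \<in> D\<^sup>*" if "x \<in> pverts (add_root G)" for x
    using that to_root by (auto simp: pverts_add_root)
  ultimately have
    "maximal_elements (pverts (add_root G)) (generated_order (pverts (add_root G)) D) = {None}"
    by (auto simp: maximal_elements_def generated_order_def pverts_add_root)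
  with acyclic show "D \<in> root_maximal_orientations G"
    by (simp add: root_maximal_orientations_def)
qed

lemma no_arc_from_root:
  assumes "D \<in> root_maximal_orientations G"
  shows "(None, y) \<notin> D"
  using assms unfolding root_maximal_orientations_eq acyclic_orientation_def add_root_def
  by fastforce

lemma generated_order_restrict_orientation:
  assumes "D \<in> root_maximal_orientations G"
  shows "generated_order (pverts G) (restrict_orientation G D)
    = {(u, v). (Some u, Some v) \<in> generated_order (pverts (add_root G)) D}"
proof -
  have D: "D \<subseteq> parcs (add_root G)"
    using assms by (simp add: root_maximal_orientations_eq acyclic_orientation_def)
  have "(Some u, Some v) \<in> D\<^sup>*" if "(u, v) \<in> (restrict_orientation G D)\<^sup>*" for u v
    using that by induction (auto simp: restrict_orientation_def intro: rtrancl_into_rtrancl)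
  moreover have "(u, v) \<in> (restrict_orientation G D)\<^sup>*" if "(Some u, Some v) \<in> D\<^sup>*" for u v
  proof -
    have "\<exists>w. x = Some w \<and> (w, v) \<in> (restrict_orientation G D)\<^sup>*" if "(x, Some v) \<in> D\<^sup>*" for x
      using that
    proof (induction rule: converse_rtrancl_induct)
      case (step x y)
      then obtain u w where "x = Some u" "y = Some w" "(w, v) \<in> (restrict_orientation G D)\<^sup>*"
        using no_arc_from_root[OF assms] by (cases x) auto
      moreover from this step D have "(u, w) \<in> restrict_orientation G D"
        by (auto simp: restrict_orientation_def add_root_def)
      ultimately show ?case by (auto intro: converse_rtrancl_into_rtrancl)
    qed simp
    with that show ?thesis by blast
  qed
  ultimately show ?thesis
    by (auto simp: generated_order_def pverts_add_root)
qed

lemma num_linear_extensions_restrict_orientation: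
  assumes "finite (pverts G)" and D: "D \<in> root_maximal_orientations G"
  shows "num_linear_extensions G (restrict_orientation G D) = num_linear_extensions (add_root G) D"
proof -
  have "(None, Some v) \<notin> D\<^sup>*" for v
    using no_arc_from_root[OF D] by (auto elim: converse_rtranclE)
  moreover have "(Some v, None) \<in> D" if "v \<in> pverts G" for v
    using D that by (simp add: root_maximal_orientations_eq)
  ultimately show ?thesis
    unfolding num_linear_extensions_def generated_order_restrict_orientation[OF D]
    unfolding pverts_add_root
    by (intro card_linear_extensions_add_top[symmetric] assms) (auto simp: generated_order_def)
qed

section \<open>The sliding process\<close>

abbreviation swap_labels :: "'b \<Rightarrow> 'b \<Rightarrow> ('b \<Rightarrow> nat) \<Rightarrow> 'b \<Rightarrow> nat" where
  "swap_labels v w f \<equiv> f \<circ> Transposition.transpose v w"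

locale sliding = pair_graph H for H :: "'b pair_pre_digraph" +
  fixes f0 :: "'b \<Rightarrow> nat"
  assumes start_bij: "bij_betw f0 (pverts H) {1..card (pverts H)}"
    and nonempty: "pverts H \<noteq> {}"
    and neighbors_nonempty: "v \<in> pverts H \<Longrightarrow> neighbors H v \<noteq> {}"
begin

text \<open>
  Outside the vertex set, a labelling has the arbitrary values of \<open>f0\<close>, which the process keeps.
\<close>

definition labellings :: "('b \<Rightarrow> nat) set" where
  "labellings = {f. bij_betw f (pverts H) {1..card (pverts H)} \<and> (\<forall>x. x \<notin> pverts H \<longrightarrow> f x = f0 x)}"

definition slides :: "('b \<Rightarrow> nat) \<Rightarrow> ('b \<Rightarrow> nat) set" where
  "slides f = (\<lambda>w. swap_labels (top_vertex H f) w f) ` neighbors H (top_vertex H f)"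

definition moves :: "('b \<Rightarrow> nat) rel" where
  "moves = {(f, g). f \<in> labellings \<and> g \<in> slides f}"

lemma neighbors_subset: "neighbors H v \<subseteq> pverts H"
  using in_arcsD2 by (auto simp: neighbors_def)

lemma finite_neighbors: "finite (neighbors H v)"
  using pair_finite_verts neighbors_subset finite_subset by blast

lemma start_labelling: "f0 \<in> labellings"
  using start_bij by (simp add: labellings_def)

lemma labelling_bij: "f \<in> labellings \<Longrightarrow> bij_betw f (pverts H) {1..card (pverts H)}"
  by (simp add: labellings_def)

lemma labelling_inj: "f \<in> labellings \<Longrightarrow> inj_on f (pverts H)"
  using labelling_bij bij_betw_def by blast

lemma labelling_eq_iff:
  "f \<in> labellings \<Longrightarrow> x \<in> pverts H \<Longrightarrow> y \<in> pverts H \<Longrightarrow> f x = f y \<longleftrightarrow> x = y"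
  using labelling_inj inj_on_eq_iff by metis

lemma labelling_range: "f \<in> labellings \<Longrightarrow> x \<in> pverts H \<Longrightarrow> f x \<in> {1..card (pverts H)}"
  using labelling_bij bij_betwE by blast

lemma labelling_comp:
  assumes "f \<in> labellings" and "p permutes pverts H"
  shows "f \<circ> p \<in> labellings"
  using assms bij_betw_trans[OF permutes_imp_bij[OF assms(2)] labelling_bij[OF assms(1)]]
  by (auto simp: labellings_def permutes_not_in)

lemma labelling_permuted:
  assumes f: "f \<in> labellings" and g: "g \<in> labellings"
  obtains p where "p permutes pverts H" and "g = f \<circ> p"
proof
  let ?p = "\<lambda>x. if x \<in> pverts H then inv_into (pverts H) f (g x) else x"
  have "bij_betw (inv_into (pverts H) f \<circ> g) (pverts H) (pverts H)"
    using bij_betw_trans[OF labelling_bij[OF g] bij_betw_inv_into[OF labelling_bij[OF f]]] .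
  then have "bij_betw ?p (pverts H) (pverts H)"
    by (rule bij_betw_cong[THEN iffD1, rotated]) simp
  then show "?p permutes pverts H"
    by (rule bij_imp_permutes) simp
  show "g = f \<circ> ?p"
  proof
    fix x show "g x = (f \<circ> ?p) x"
      using f g bij_betw_inv_into_right[OF labelling_bij[OF f] labelling_range[OF g]]
      by (cases "x \<in> pverts H") (auto simp: labellings_def)
  qed
qed

lemma inj_on_comp_labelling:
  assumes "f \<in> labellings"
  shows "inj_on ((\<circ>) f) {p. p permutes pverts H}"
proof (intro inj_onI ext)
  fix p q x
  assume p: "p \<in> {p. p permutes pverts H}" and q: "q \<in> {p. p permutes pverts H}"
    and eq: "f \<circ> p = f \<circ> q"
  show "p x = q x"
  proof (cases "x \<in> pverts H")
    case True
    then have "p x \<in> pverts H" "q x \<in> pverts H" using p q by (simp_all add: permutes_in_image)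
    with labelling_eq_iff[OF assms] fun_cong[OF eq, of x] show ?thesis by simp
  qed (use p q in \<open>auto simp: permutes_not_in\<close>)
qed

lemma finite_labellings: "finite labellings"
proof (rule finite_subset)
  show "labellings \<subseteq> (\<circ>) f0 ` {p. p permutes pverts H}"
    using labelling_permuted[OF start_labelling] by blast
qed (simp add: finite_permutations pair_finite_verts)

lemma bij_betw_restrict_labellings:
  assumes D: "acyclic_orientation H D"
  shows "bij_betw (\<lambda>f. restrict f (pverts H)) {f \<in> labellings. induced_orientation H f = D}
    (linear_extensions (pverts H) (generated_order (pverts H) D))"
proof (rule bij_betw_byWitness[where f' = "\<lambda>h x. if x \<in> pverts H then h x else f0 x"])
  let ?V = "pverts H" and ?P = "generated_order (pverts H) D"
  let ?extend = "\<lambda>h x. if x \<in> pverts H then h x else f0 x"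
  have subset: "?P \<subseteq> ?V \<times> ?V" by (auto simp: generated_order_def)
  have induces_iff: "induced_orientation H f = D \<longleftrightarrow> (\<forall>(x, y)\<in>?P. f x \<le> f y)"
    if "f \<in> labellings" for f
    using induced_orientation_eq_iff[OF _ labelling_inj[OF that] D] pair_graph_axioms by blast
  show "\<forall>f\<in>{f \<in> labellings. induced_orientation H f = D}. ?extend (restrict f ?V) = f"
    by (auto simp: labellings_def)
  show "\<forall>h\<in>linear_extensions ?V ?P. restrict (?extend h) ?V = h"
    by (auto simp: linear_extensions_def PiE_def extensional_def fun_eq_iff)
  show "(\<lambda>f. restrict f ?V) ` {f \<in> labellings. induced_orientation H f = D}
      \<subseteq> linear_extensions ?V ?P"
  proof clarify
    fix f assume f: "f \<in> labellings" and "D = induced_orientation H f"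
    then have "\<forall>(x, y)\<in>?P. f x \<le> f y" using induces_iff by blast
    with subset labelling_bij[OF f] labelling_range[OF f]
    show "restrict f ?V \<in> linear_extensions ?V (generated_order ?V (induced_orientation H f))"
      unfolding linear_extensions_def \<open>D = induced_orientation H f\<close> by fastforce
  qed
  show "?extend ` linear_extensions ?V ?P \<subseteq> {f \<in> labellings. induced_orientation H f = D}"
  proof clarify
    fix h assume h: "h \<in> linear_extensions ?V ?P"
    have "bij_betw (?extend h) ?V {1..card ?V} \<longleftrightarrow> bij_betw h ?V {1..card ?V}"
      by (rule bij_betw_cong) simp
    with h have "?extend h \<in> labellings" by (simp add: labellings_def linear_extensions_def)
    moreover have "\<forall>(x, y)\<in>?P. ?extend h x \<le> ?extend h y"
      using h subset by (auto simp: linear_extensions_def)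
    ultimately show "?extend h \<in> labellings \<and> induced_orientation H (?extend h) = D"
      using induces_iff by blast
  qed
qed

lemma card_labellings_inducing:
  assumes "acyclic_orientation H D"
  shows "card {f \<in> labellings. induced_orientation H f = D} = num_linear_extensions H D"
  unfolding num_linear_extensions_def
  using assms by (rule bij_betw_same_card[OF bij_betw_restrict_labellings])

lemma top_vertex_eq:
  assumes "f \<in> labellings" and "v \<in> pverts H" and "f v = card (pverts H)"
  shows "top_vertex H f = v"
  unfolding top_vertex_def using assms labelling_eq_iff[OF assms(1) _ assms(2)]
  by (intro the_equality) auto

lemma top_vertex:
  assumes "f \<in> labellings"
  shows "top_vertex H f \<in> pverts H" and "f (top_vertex H f) = card (pverts H)"
proof -
  have "card (pverts H) \<in> f ` pverts H"
    using labelling_bij[OF assms] pair_finite_verts nonempty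
    by (simp add: bij_betw_def Suc_le_eq card_gt_0_iff)
  then obtain v where "v \<in> pverts H" "f v = card (pverts H)" by force
  with top_vertex_eq[OF assms this]
  show "top_vertex H f \<in> pverts H" "f (top_vertex H f) = card (pverts H)"
    by auto
qed

lemma swap_top:
  assumes "f \<in> labellings" and "w \<in> pverts H"
  shows "swap_labels (top_vertex H f) w f \<in> labellings"
    and "top_vertex H (swap_labels (top_vertex H f) w f) = w"
proof -
  show labelling: "swap_labels (top_vertex H f) w f \<in> labellings"
    using assms top_vertex by (intro labelling_comp permutes_swap_id) auto
  show "top_vertex H (swap_labels (top_vertex H f) w f) = w"
    using assms top_vertex by (intro top_vertex_eq[OF labelling]) auto
qed

lemma inj_on_swap_top:
  assumes "f \<in> labellings"
  shows "inj_on (\<lambda>w. swap_labels (top_vertex H f) w f) (neighbors H (top_vertex H f))"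
  by (rule inj_on_inverseI[where g = "top_vertex H"])
    (use swap_top(2)[OF assms] neighbors_subset in blast)

lemma card_slides: "f \<in> labellings \<Longrightarrow> card (slides f) = card (neighbors H (top_vertex H f))"
  unfolding slides_def by (intro card_image inj_on_swap_top)

lemma slides_nonempty: "f \<in> labellings \<Longrightarrow> slides f \<noteq> {}"
  using top_vertex(1) neighbors_nonempty by (simp add: slides_def)

lemma finite_slides: "finite (slides f)"
  using finite_neighbors by (simp add: slides_def)

lemma slides_subset: "f \<in> labellings \<Longrightarrow> slides f \<subseteq> labellings"
  using swap_top(1) neighbors_subset by (auto simp: slides_def)

lemma slide_eq:
  assumes "f \<in> labellings"
  shows "slide H f = pmf_of_set (slides f)"
proof -
  have "f(v := f w, w := f v) = swap_labels v w f" for v w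
    by (auto simp: fun_eq_iff Transposition.transpose_def)
  then have "slide H f = map_pmf (\<lambda>w. swap_labels (top_vertex H f) w f)
      (pmf_of_set (neighbors H (top_vertex H f)))"
    by (simp add: slide_def map_pmf_def Let_def)
  also have "\<dots> = pmf_of_set (slides f)"
    unfolding slides_def using assms
    by (intro map_pmf_of_set_inj inj_on_swap_top neighbors_nonempty top_vertex finite_neighbors)
  finally show ?thesis .
qed

lemma slides_sym:
  assumes "f \<in> labellings" and "g \<in> slides f"
  shows "f \<in> slides g"
proof -
  obtain w where w: "w \<in> neighbors H (top_vertex H f)" and g: "g = swap_labels (top_vertex H f) w f"
    using assms(2) by (auto simp: slides_def)
  have "top_vertex H g = w"
    using swap_top(2)[OF assms(1)] w neighbors_subset g by blast
  moreover have "top_vertex H f \<in> neighbors H w"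
    using w arcs_symmetric by (simp add: neighbors_def)
  moreover have "f = swap_labels w (top_vertex H f) g"
    by (simp add: g comp_assoc Transposition.transpose_commute[of w])
  ultimately show ?thesis by (auto simp: slides_def)
qed

lemma sym_moves: "sym moves"
  using slides_sym slides_subset by (auto simp: moves_def intro!: symI)

lemma slide_along_arc:
  assumes "f \<in> labellings" and "f v = card (pverts H)" and "(v, w) \<in> parcs H"
  shows "(f, swap_labels v w f) \<in> moves" and "swap_labels v w f \<in> labellings"
    and "swap_labels v w f w = card (pverts H)"
proof -
  have "top_vertex H f = v" using assms in_arcsD1 by (intro top_vertex_eq) auto
  then show "(f, swap_labels v w f) \<in> moves"
    using assms by (auto simp: moves_def slides_def neighbors_def)
  then show "swap_labels v w f \<in> labellings"
    using slides_subset by (auto simp: moves_def)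
  show "swap_labels v w f w = card (pverts H)" using assms(2) by simp
qed

end

section \<open>The sliding process on a graph with an added root\<close>

locale rooted_sliding = base: pair_graph G for G :: "'a pair_pre_digraph" +
  fixes f0 :: "'a option \<Rightarrow> nat"
  assumes base_connected: "Digraph_Component.connected (with_proj G)"
    and root_start_bij: "bij_betw f0 (pverts (add_root G)) {1..card (pverts (add_root G))}"
begin

lemma base_reachable:
  assumes "u \<in> pverts G" and "v \<in> pverts G"
  shows "(u, v) \<in> (parcs G)\<^sup>*"
  using assms base_connected base.reachable_mk_symmetric_eq[OF base.sym_arcs]
  by (auto simp: Digraph_Component.connected_def strongly_connected_def base.reachable_conv)

lemma base_nonempty: "pverts G \<noteq> {}"
  using base_connected by (simp add: Digraph_Component.connected_def strongly_connected_def)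

sublocale sliding "add_root G" f0
proof -
  interpret rooted: pair_graph "add_root G"
    by (rule pair_graph_add_root) unfold_locales
  show "sliding (add_root G) f0"
    using root_start_bij base_nonempty
    by unfold_locales (auto simp: neighbors_def add_root_def)
qed

definition root_top_labellings :: "('a option \<Rightarrow> nat) set" where
  "root_top_labellings = {f \<in> labellings. f None = card (pverts (add_root G))}"

lemma root_top_subset: "root_top_labellings \<subseteq> labellings"
  by (auto simp: root_top_labellings_def)

lemma root_top_comp:
  assumes "f \<in> root_top_labellings" and "p permutes Some ` pverts G"
  shows "f \<circ> p \<in> root_top_labellings"
proof -
  have "p permutes pverts (add_root G)"
    by (rule permutes_subset[OF assms(2)]) (auto simp: pverts_add_root)
  moreover have "p None = None" using assms(2) by (auto simp: permutes_not_in)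
  ultimately show ?thesis
    using assms(1) labelling_comp by (auto simp: root_top_labellings_def)
qed

lemma root_top_labellings_eq:
  assumes "f \<in> root_top_labellings"
  shows "root_top_labellings = (\<circ>) f ` {p. p permutes Some ` pverts G}"
proof (intro equalityI subsetI)
  fix g assume g: "g \<in> root_top_labellings"
  obtain p where p: "p permutes pverts (add_root G)" "g = f \<circ> p"
    using labelling_permuted assms g root_top_subset by blast
  have "p None \<in> pverts (add_root G)"
    using permutes_in_image[OF p(1)] by (simp add: pverts_add_root)
  moreover have "f (p None) = f None"
    using assms g p(2) by (simp add: root_top_labellings_def)
  ultimately have "p None = None"
    using labelling_eq_iff[of f "p None" None] assms
    by (simp add: root_top_labellings_def pverts_add_root)
  then have "p permutes Some ` pverts G"
    by (intro permutes_superset[OF p(1)]) (auto simp: pverts_add_root)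
  with p(2) show "g \<in> (\<circ>) f ` {p. p permutes Some ` pverts G}" by blast
qed (use root_top_comp[OF assms] in auto)

lemma swap_along_edge:
  assumes "f \<in> root_top_labellings" and "(u, v) \<in> parcs G"
  shows "(f, swap_labels (Some u) (Some v) f) \<in> moves\<^sup>*"
proof -
  have arcs: "(None, Some u) \<in> parcs (add_root G)" "(Some u, Some v) \<in> parcs (add_root G)"
      "(Some v, None) \<in> parcs (add_root G)"
    using assms(2) base.in_arcsD1[OF assms(2)] base.in_arcsD2[OF assms(2)]
    by (auto simp: add_root_def)
  have f: "f \<in> labellings" "f None = card (pverts (add_root G))"
    using assms(1) by (auto simp: root_top_labellings_def)
  note first = slide_along_arc[OF f arcs(1)]
  note second = slide_along_arc[OF first(2,3) arcs(2)]
  note third = slide_along_arc[OF second(2,3) arcs(3)]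
  have "u \<noteq> v"
    using assms(2) base.no_loops' by blast
  then have "swap_labels (Some v) None (swap_labels (Some u) (Some v) (swap_labels None (Some u) f))
      = swap_labels (Some u) (Some v) f"
    by (auto simp: fun_eq_iff Transposition.transpose_def)
  with first(1) second(1) third(1) show ?thesis
    by (metis converse_rtrancl_into_rtrancl r_into_rtrancl)
qed

lemma root_top_connected:
  assumes "f \<in> root_top_labellings" and "g \<in> root_top_labellings"
  shows "(f, g) \<in> moves\<^sup>*"
proof -
  let ?R = "map_prod Some Some ` parcs G"
  obtain p where p: "p permutes Some ` pverts G" and g: "g = f \<circ> p"
    using assms root_top_labellings_eq[OF assms(1)] by blast
  have "(Some u, Some v) \<in> ?R\<^sup>*" if "(u, v) \<in> (parcs G)\<^sup>*" for u v
    using that by induction (auto intro: rtrancl_into_rtrancl)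
  then have "Some ` pverts G \<times> Some ` pverts G \<subseteq> ?R\<^sup>*"
    using base_reachable by blast
  moreover have "?R \<subseteq> Some ` pverts G \<times> Some ` pverts G"
    using base.in_arcsD1 base.in_arcsD2 by auto
  moreover have "finite (Some ` pverts G)"
    by (simp add: base.pair_finite_verts)
  ultimately have "(f, f \<circ> p) \<in> moves\<^sup>*"
    using p
  proof (induction rule: permutes_connected_induct)
    case (transpose p a b)
    then obtain u v where "a = Some u" "b = Some v" "(u, v) \<in> parcs G" by auto
    with swap_along_edge[OF root_top_comp[OF assms(1) transpose.hyps(1)]]
    have "(f \<circ> p, swap_labels a b (f \<circ> p)) \<in> moves\<^sup>*" by blast
    with transpose.IH show ?case unfolding comp_assoc by (rule rtrancl_trans)
  qed simp
  with g show ?thesis by simp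
qed

lemma reach_root_top:
  assumes "f \<in> labellings"
  obtains g where "g \<in> root_top_labellings" and "(f, g) \<in> moves\<^sup>*"
proof (cases "top_vertex (add_root G) f = None")
  case True
  then show ?thesis
    using that[of f] top_vertex[OF assms] assms by (auto simp: root_top_labellings_def)
next
  case False
  then have "(top_vertex (add_root G) f, None) \<in> parcs (add_root G)"
    using top_vertex(1)[OF assms] by (auto simp: add_root_def)
  from slide_along_arc[OF assms top_vertex(2)[OF assms] this] show ?thesis
    by (intro that[of "swap_labels (top_vertex (add_root G) f) None f"])
      (auto simp: root_top_labellings_def)
qed

lemma labellings_connected:
  assumes "f \<in> labellings" and "g \<in> labellings"
  shows "(f, g) \<in> moves\<^sup>*"
proof -
  obtain f' where f': "f' \<in> root_top_labellings" "(f, f') \<in> moves\<^sup>*"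
    using reach_root_top[OF assms(1)] .
  obtain g' where g': "g' \<in> root_top_labellings" "(g, g') \<in> moves\<^sup>*"
    using reach_root_top[OF assms(2)] .
  have "(g', g) \<in> moves\<^sup>*"
    using g'(2) sym_rtrancl[OF sym_moves] by (auto dest: symD)
  with f'(2) root_top_connected[OF f'(1) g'(1)] show ?thesis
    by (blast intro: rtrancl_trans)
qed

sublocale walk: finite_irreducible_chain labellings "slide (add_root G)"
  "\<lambda>f. real (card (slides f))" "sliding_labelling (add_root G) f0"
proof
  have set_pmf_slide: "set_pmf (slide (add_root G) f) = slides f" if "f \<in> labellings" for f
    using that slide_eq slides_nonempty finite_slides by simp
  show "set_pmf (slide (add_root G) f) \<subseteq> labellings" if "f \<in> labellings" for f
    using set_pmf_slide slides_subset that by simp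
  have "{(f, g). f \<in> labellings \<and> g \<in> set_pmf (slide (add_root G) f)} = moves"
    using set_pmf_slide by (auto simp: moves_def)
  then show "(f, g) \<in> {(f, g). f \<in> labellings \<and> g \<in> set_pmf (slide (add_root G) f)}\<^sup>*"
    if "f \<in> labellings" "g \<in> labellings" for f g
    using labellings_connected[OF that] by simp
  show "(\<Sum>f\<in>labellings. card (slides f) * pmf (slide (add_root G) f) g) = card (slides g)"
    if "g \<in> labellings" for g
    using simple_random_walk_degree_invariant[OF finite_labellings slides_subset slides_nonempty
        slides_sym that]
    by (simp add: slide_eq)
  show "0 < real (card (slides f))" if "f \<in> labellings" for f
    using slides_nonempty[OF that] finite_slides by (simp add: card_gt_0_iff)
qed (use finite_labellings start_labelling in auto)

lemma prob_sliding_orientation: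
  "measure_pmf.prob (sliding_orientation G f0 t) X =
    measure_pmf.prob (sliding_labelling (add_root G) f0 t)
      {f \<in> labellings. induced_orientation (add_root G) f \<in> X}"
  unfolding sliding_orientation_def measure_map_pmf
  using walk.set_pmf_law[of t]
  by (intro measure_pmf.finite_measure_eq_AE) (auto simp: AE_measure_pmf_iff)

lemma labellings_inducing_root_maximal:
  "{f \<in> labellings. induced_orientation (add_root G) f \<in> root_maximal_orientations G}
    = root_top_labellings"
proof -
  have "(\<forall>v\<in>pverts G. f (Some v) < f None) \<longleftrightarrow> f None = card (pverts (add_root G))"
    if f: "f \<in> labellings" for f
  proof
    assume root: "\<forall>v\<in>pverts G. f (Some v) < f None"
    have "f x \<le> f None" if "x \<in> pverts (add_root G)" for x
      using that root by (auto simp: pverts_add_root)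
    from this[OF top_vertex(1)[OF f]] labelling_range[OF f, of None]
    show "f None = card (pverts (add_root G))"
      by (simp add: top_vertex(2)[OF f] pverts_add_root)
  next
    assume root: "f None = card (pverts (add_root G))"
    have "f (Some v) \<le> f None" "f (Some v) \<noteq> f None" if "v \<in> pverts G" for v
      using that labelling_range[OF f, of "Some v"] labelling_eq_iff[OF f, of "Some v" None] root
      by (auto simp: pverts_add_root)
    then show "\<forall>v\<in>pverts G. f (Some v) < f None" by fastforce
  qed
  moreover have "acyclic_orientation (add_root G) (induced_orientation (add_root G) f)"
    if "f \<in> labellings" for f
    using that by (intro acyclic_orientation_induced labelling_inj) unfold_locales
  ultimately show ?thesis
    by (auto simp: root_maximal_orientations_eq root_top_labellings_def induced_orientation_def
        add_root_def)
qed

lemma prob_root_maximal_orientations: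
  "measure_pmf.prob (sliding_orientation G f0 t) (root_maximal_orientations G) =
    measure_pmf.prob (sliding_labelling (add_root G) f0 t) root_top_labellings"
  by (simp add: prob_sliding_orientation labellings_inducing_root_maximal)

lemma card_labellings_inducing_root_maximal:
  assumes "D \<in> root_maximal_orientations G"
  shows "card {f \<in> labellings. induced_orientation (add_root G) f = D}
    = num_linear_extensions G (restrict_orientation G D)"
  using assms card_labellings_inducing
    num_linear_extensions_restrict_orientation[OF base.pair_finite_verts assms]
  by (simp add: root_maximal_orientations_eq)

lemma root_top_nonempty: "root_top_labellings \<noteq> {}"
  using reach_root_top[OF start_labelling] by blast

lemma card_root_top_labellings: "card root_top_labellings = fact (card (pverts G))"
proof -
  obtain f where f: "f \<in> root_top_labellings" using root_top_nonempty by blast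
  have "{p. p permutes Some ` pverts G} \<subseteq> {p. p permutes pverts (add_root G)}"
    by (auto simp: pverts_add_root intro: permutes_subset)
  then have "inj_on ((\<circ>) f) {p. p permutes Some ` pverts G}"
    using inj_on_comp_labelling f root_top_subset inj_on_subset by blast
  then have "card root_top_labellings = card {p. p permutes Some ` pverts G}"
    unfolding root_top_labellings_eq[OF f] by (rule card_image)
  also have "\<dots> = fact (card (pverts G))"
    by (intro card_permutations) (simp_all add: card_image base.pair_finite_verts)
  finally show ?thesis .
qed

lemma card_slides_root_top:
  assumes "f \<in> root_top_labellings"
  shows "card (slides f) = card (pverts G)"
proof -
  have "top_vertex (add_root G) f = None"
    using assms by (intro top_vertex_eq) (auto simp: root_top_labellings_def pverts_add_root)
  moreover have "neighbors (add_root G) None = Some ` pverts G"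
    by (auto simp: neighbors_def add_root_def)
  ultimately show ?thesis
    using card_slides assms root_top_subset by (auto simp: card_image)
qed

lemma root_top_frequency_tendsto:
  assumes "B \<subseteq> root_top_labellings"
  shows "(\<lambda>N. (\<Sum>t=1..N. measure_pmf.prob (sliding_labelling (add_root G) f0 t) B) /
      (\<Sum>t=1..N. measure_pmf.prob (sliding_labelling (add_root G) f0 t) root_top_labellings))
    \<longlonglongrightarrow> card B / fact (card (pverts G))"
proof -
  have degree_sum: "(\<Sum>f\<in>A. real (card (slides f))) = card (pverts G) * card A"
    if "A \<subseteq> root_top_labellings" for A
    using that card_slides_root_top by (subst sum.cong[where h = "\<lambda>_. real (card (pverts G))"]) auto
  have "card (pverts G) \<noteq> 0"
    using base_nonempty base.pair_finite_verts by simp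
  then show ?thesis
    using walk.sum_prob_ratio_tendsto[OF root_top_subset root_top_nonempty, of B]
      assms root_top_subset
    by (simp add: degree_sum card_root_top_labellings)
qed

end

theorem theorem5p8:
  fixes G :: "'a pair_pre_digraph" and n :: nat and f0 :: "'a option \<Rightarrow> nat"
  assumes "pair_graph G"
    and "Digraph_Component.connected (with_proj G)"
    and "card (pverts G) = n"
    and "bij_betw f0 (pverts (add_root G)) {1..n + 1}"
  shows "(\<Sum>t. ennreal (measure_pmf.prob (sliding_orientation G f0 (t + 1))
           (root_maximal_orientations G))) = \<infinity>
    \<and> (\<forall>D \<in> root_maximal_orientations G.
      (\<lambda>N. (\<Sum>t=1..N. measure_pmf.prob (sliding_orientation G f0 t) {D}) /
            (\<Sum>t=1..N. measure_pmf.prob (sliding_orientation G f0 t) (root_maximal_orientations G)))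
        \<longlonglongrightarrow> real (num_linear_extensions G (restrict_orientation G D)) / fact n)"
proof -
  have "card (pverts (add_root G)) = n + 1"
    using bij_betw_same_card[OF assms(4)] by simp
  then interpret rooted_sliding G f0
    using assms by (simp add: rooted_sliding_def rooted_sliding_axioms_def)
  show ?thesis
    unfolding prob_root_maximal_orientations
  proof (intro conjI ballI)
    show "(\<Sum>t. ennreal (measure_pmf.prob (sliding_labelling (add_root G) f0 (t + 1))
        root_top_labellings)) = \<infinity>"
      using root_top_subset root_top_nonempty by (rule walk.suminf_prob_eq_infinity)
  next
    fix D assume D: "D \<in> root_maximal_orientations G"
    then have "{f \<in> labellings. induced_orientation (add_root G) f = D} \<subseteq> root_top_labellings"
      unfolding labellings_inducing_root_maximal[symmetric] by blast
    from root_top_frequency_tendsto[OF this]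
    show "(\<lambda>N. (\<Sum>t=1..N. measure_pmf.prob (sliding_orientation G f0 t) {D}) /
        (\<Sum>t=1..N. measure_pmf.prob (sliding_labelling (add_root G) f0 t) root_top_labellings))
      \<longlonglongrightarrow> real (num_linear_extensions G (restrict_orientation G D)) / fact n"
      by (simp add: prob_sliding_orientation card_labellings_inducing_root_maximal[OF D] assms(3))
  qed
qed

end
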